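(* Suppose that $\{X_t,t\in\mathbb{R}\}$ is a h.-i.s.r.m.-process on $\mathbb{R}^d$, $t_0\in\mathbb{R}$, $c>0$, $b>1$, and $M$ is an $\mathbb{R}^d$-valued random variable. Then the process $$Z_t=b^{-([ct]-[ct_0])}M+b^{-[ct]}\int_{[ct_0]/c}^{[ct]/c}b^{[cs]}\,dX_s,\qquad t\ge t_0,$$ is an almost surely unique solution of the Langevin type equation $$Z_t=M+X_{[ct]/c}-X_{[ct_0]/c}-(b-1)\int_{t_0}^t Z_s\,d[cs],\qquad t\ge t_0.$$
   Context: $[x]$ is the largest integer not greater than $x\in\mathbb{R}$. An $\mathbb{R}^d$-valued independently scattered random measure (i.s.r.m.) over $\mathbb{R}$ is a family $X=\{X(B)\}$ of $\mathbb{R}^d$-valued random variables indexed by the bounded Borel sets $B\subset\mathbb{R}$ such that $X(B_1),\dots,X(B_n)$ are independent for disjoint $B_1,\dots,B_n$; $X(\bigcup_n B_n)=\sum_n X(B_n)$ a.s. (with a.s. convergence) for disjoint $B_n$ with bounded union; and $X(\{a\})=0$ a.s. for every $a$. It is homogeneous if $\mathcal{L}(X(B))=\mathcal{L}(X(B+a))$ for all $B$ and $a\in\mathbb{R}$. A process $\{X_t,t\in\mathbb{R}\}$ is a h.-i.s.r.m.-process if there is a homogeneous i.s.r.m. $X$ over $\mathbb{R}$ with $X_t=X((0,t])$ for $t>0$, $X_0=0$, $X_t=-X((t,0])$ for $t<0$, taken in a càdlàg modification (i.e. a two-sided Lévy process). For $s\le t$, $\int_s^t f(u)\,dX_u$ is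 the stochastic integral of a nonrandom function over $(s,t]$ with respect to $X$; for the step function here, $\int_{k/c}^{n/c}b^{[cs]}dX_s=\sum_{\ell=k+1}^{n}b^{\ell-1}(X_{\ell/c}-X_{(\ell-1)/c})$ for integers $k\le n$. $d[cs]$ is the Lebesgue–Stieltjes measure of $s\mapsto[cs]$, i.e. $\sum_{k\in\mathbb{Z}}\delta_{k/c}(ds)$, and $\int_\alpha^\beta f(s)\,d[cs]$ means the integral over $(\alpha,\beta]$ (a finite sum). A process $\{Z_t,t\ge t_0\}$ is a solution of the equation if its sample paths are right-continuous with left limits and it satisfies the equation (for all $t\ge t_0$) almost surely. Almost sure uniqueness means that any two solutions coincide for all $t\ge t_0$ with probability one. *)

theory Defs
  imports "HOL-Probability.Probability"
begin

definition bounded_borel :: "real set set" where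
  "bounded_borel = {B \<in> sets borel. bounded B}"

definition isrm :: "'w measure \<Rightarrow> (real set \<Rightarrow> 'w \<Rightarrow> 'a::euclidean_space) \<Rightarrow> bool" where
  "isrm P X \<longleftrightarrow>
     (\<forall>B\<in>bounded_borel. X B \<in> borel_measurable P) \<and>
     (\<forall>(n::nat) B. (\<forall>i<n. B i \<in> bounded_borel) \<longrightarrow> disjoint_family_on B {..<n} \<longrightarrow>
        prob_space.indep_vars P (\<lambda>_. borel) (\<lambda>i. X (B i)) {..<n}) \<and>
     (\<forall>B::nat \<Rightarrow> real set. (\<forall>n. B n \<in> bounded_borel) \<longrightarrow> disjoint_family B \<longrightarrow>
        bounded (\<Union>n. B n) \<longrightarrow>
        (AE \<omega> in P. (\<lambda>n. X (B n) \<omega>) sums X (\<Union>n. B n) \<omega>)) \<and>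
     (\<forall>a. AE \<omega> in P. X {a} \<omega> = 0)"

definition homogeneous :: "'w measure \<Rightarrow> (real set \<Rightarrow> 'w \<Rightarrow> 'a::euclidean_space) \<Rightarrow> bool" where
  "homogeneous P X \<longleftrightarrow>
     (\<forall>B\<in>bounded_borel. \<forall>a. distr P borel (X B) = distr P borel (X ((\<lambda>x. x + a) ` B)))"

text \<open>At a left endpoint of \<open>T\<close> the filter in the second conjunct is trivial, so no left limit is
  demanded there.\<close>
definition cadlag_on :: "real set \<Rightarrow> (real \<Rightarrow> 'a::topological_space) \<Rightarrow> bool" where
  "cadlag_on T f \<longleftrightarrow>
     (\<forall>t\<in>T. (f \<longlongrightarrow> f t) (at t within T \<inter> {t<..}) \<and>
            (\<exists>l. (f \<longlongrightarrow> l) (at t within T \<inter> {..<t})))"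

text \<open>\<open>Y\<close> is the h.-i.s.r.m.-process of \<open>X\<close>. Being a modification of the process defined
  from \<open>X\<close>, it is only required to agree with it almost surely for each fixed time.\<close>
definition hisrm_process ::
  "'w measure \<Rightarrow> (real set \<Rightarrow> 'w \<Rightarrow> 'a::euclidean_space) \<Rightarrow> (real \<Rightarrow> 'w \<Rightarrow> 'a) \<Rightarrow> bool" where
  "hisrm_process P X Y \<longleftrightarrow>
     isrm P X \<and> homogeneous P X \<and>
     (\<forall>t. Y t \<in> borel_measurable P) \<and>
     (\<forall>t. AE \<omega> in P. Y t \<omega> =
        (if 0 < t then X {0<..t} \<omega> else if t < 0 then - X {t<..0} \<omega> else 0)) \<and>
     (\<forall>\<omega>\<in>space P. cadlag_on UNIV (\<lambda>t. Y t \<omega>))"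

text \<open>The stochastic integral over \<open>(s, t]\<close> of a nonrandom Borel function with finitely many
  values there: \<open>\<Sum>\<^sub>j a\<^sub>j X(B\<^sub>j)\<close> for \<open>f = \<Sum>\<^sub>j a\<^sub>j 1\<^sub>B\<^sub>j\<close> on \<open>(s, t]\<close>, where the \<open>B\<^sub>j\<close> are the level sets.
  It has no meaning for other integrands.\<close>
definition stoch_integral ::
  "(real set \<Rightarrow> 'w \<Rightarrow> 'a::euclidean_space) \<Rightarrow> real \<Rightarrow> real \<Rightarrow> (real \<Rightarrow> real) \<Rightarrow> 'w \<Rightarrow> 'a" where
  "stoch_integral X s t f \<omega> =
     (\<Sum>y\<in>f ` {s<..t}. y *\<^sub>R X {u \<in> {s<..t}. f u = y} \<omega>)"

text \<open>The integrator \<open>d[cs]\<close> is the Lebesgue-Stieltjes measure of \<open>s \<mapsto> [cs]\<close>.\<close>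
definition langevin_solution ::
  "'w measure \<Rightarrow> (real \<Rightarrow> 'w \<Rightarrow> 'a::euclidean_space) \<Rightarrow> ('w \<Rightarrow> 'a) \<Rightarrow> real \<Rightarrow> real \<Rightarrow> real \<Rightarrow>
   (real \<Rightarrow> 'w \<Rightarrow> 'a) \<Rightarrow> bool" where
  "langevin_solution P Y M t0 c b Z \<longleftrightarrow>
     (\<forall>t\<ge>t0. Z t \<in> borel_measurable P) \<and>
     (\<forall>\<omega>\<in>space P. cadlag_on {t0..} (\<lambda>t. Z t \<omega>)) \<and>
     (AE \<omega> in P. \<forall>t\<ge>t0.
        Z t \<omega> = M \<omega> + Y (of_int \<lfloor>c * t\<rfloor> / c) \<omega> - Y (of_int \<lfloor>c * t0\<rfloor> / c) \<omega>
          - (b - 1) *\<^sub>R (LINT s:{t0<..t}|interval_measure (\<lambda>s. of_int \<lfloor>c * s\<rfloor>). Z s \<omega>))"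

lemma bounded_borel_Ioc [simp]: "{s<..t} \<in> bounded_borel"
  and bounded_borel_Ioo [simp]: "{s<..<t} \<in> bounded_borel"
  and bounded_borel_Ico [simp]: "{s..<t} \<in> bounded_borel"
  and bounded_borel_singleton [simp]: "{s} \<in> bounded_borel"
  and bounded_borel_empty [simp]: "{} \<in> bounded_borel"
  by (auto simp: bounded_borel_def)

lemma isrm_empty:
  assumes "isrm P X" shows "AE \<omega> in P. X {} \<omega> = 0"
proof -
  have "AE \<omega> in P. (\<lambda>n. X ((\<lambda>_::nat. {}) n) \<omega>) sums X (\<Union>n::nat. (\<lambda>_. {}) n) \<omega>"
    using assms unfolding isrm_def by (elim conjE allE[where x="\<lambda>_. {}"]) (auto simp: disjoint_family_on_def)
  then show ?thesis
    by eventually_elim (auto dest!: sums_summable simp: summable_const_iff)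
qed

lemma isrm_Un:
  assumes X: "isrm P X" and "A \<in> bounded_borel" "B \<in> bounded_borel" "A \<inter> B = {}"
  shows "AE \<omega> in P. X (A \<union> B) \<omega> = X A \<omega> + X B \<omega>"
proof -
  define C where "C = (\<lambda>n::nat. if n = 0 then A else if n = 1 then B else {})"
  have U: "(\<Union>n. C n) = A \<union> B" by (auto simp: C_def split: if_splits)
  have "AE \<omega> in P. (\<lambda>n. X (C n) \<omega>) sums X (\<Union>n. C n) \<omega>"
  proof -
    have "\<forall>n. C n \<in> bounded_borel" "disjoint_family C" "bounded (\<Union>n. C n)"
      using assms unfolding U by (auto simp: C_def disjoint_family_on_def bounded_borel_def)
    then show ?thesis using X unfolding isrm_def by blast
  qed
  then show ?thesis using isrm_empty[OF X]
  proof eventually_elim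
    case (elim \<omega>)
    have "(\<lambda>n. X (C n) \<omega>) sums (\<Sum>n<2. X (C n) \<omega>)"
      by (rule sums_finite) (use elim(2) in \<open>auto simp: C_def\<close>)
    then have "(\<lambda>n. X (C n) \<omega>) sums (X A \<omega> + X B \<omega>)"
      by (simp add: C_def numeral_2_eq_2)
    then show ?case using elim(1) U sums_unique2 by metis
  qed
qed

lemma hisrm_process_increment:
  assumes Y: "hisrm_process P X Y" and "s \<le> t"
  shows "AE \<omega> in P. Y t \<omega> - Y s \<omega> = X {s<..t} \<omega>"
proof -
  have X: "isrm P X" using Y by (simp add: hisrm_process_def)
  have Y1: "AE \<omega> in P. Y r \<omega> =
        (if 0 < r then X {0<..r} \<omega> else if r < 0 then - X {r<..0} \<omega> else 0)" for r
    using Y by (simp add: hisrm_process_def)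
  have add: "AE \<omega> in P. X {p<..r} \<omega> = X {p<..q} \<omega> + X {q<..r} \<omega>" if "p \<le> q" "q \<le> r" for p q r
    using isrm_Un[OF X, of "{p<..q}" "{q<..r}"] that by (auto simp: ivl_disj_un)
  consider "s = 0" | "0 < s" | "s < 0" "t < 0" | "s < 0" "0 \<le> t" using \<open>s \<le> t\<close> by linarith
  then show ?thesis
  proof cases
    case 1
    show ?thesis using Y1[of s] Y1[of t] isrm_empty[OF X]
      by eventually_elim (use 1 \<open>s \<le> t\<close> in auto)
  next
    case 2
    have "AE \<omega> in P. X {0<..t} \<omega> = X {0<..s} \<omega> + X {s<..t} \<omega>"
      by (rule add) (use 2 \<open>s \<le> t\<close> in auto)
    then show ?thesis using Y1[of s] Y1[of t] isrm_empty[OF X]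
      by eventually_elim (use 2 \<open>s \<le> t\<close> in \<open>auto split: if_splits\<close>)
  next
    case 3
    have "AE \<omega> in P. X {s<..0} \<omega> = X {s<..t} \<omega> + X {t<..0} \<omega>"
      by (rule add) (use 3 \<open>s \<le> t\<close> in auto)
    then show ?thesis using Y1[of s] Y1[of t]
      by eventually_elim (use 3 \<open>s \<le> t\<close> in \<open>auto split: if_splits\<close>)
  next
    case 4
    have "AE \<omega> in P. X {s<..t} \<omega> = X {s<..0} \<omega> + X {0<..t} \<omega>"
      by (rule add) (use 4 \<open>s \<le> t\<close> in auto)
    then show ?thesis using Y1[of s] Y1[of t] isrm_empty[OF X]
      by eventually_elim (use 4 \<open>s \<le> t\<close> in \<open>auto split: if_splits\<close>)
  qed
qed

text \<open>The integrand is right-continuous, so its level sets are essentially half-open on the right;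
  since single points carry no mass, the integral is a.s. the sum over the increments of the
  process.\<close>
lemma stoch_integral_step:
  fixes X :: "real set \<Rightarrow> 'w \<Rightarrow> 'a::euclidean_space"
  assumes Y: "hisrm_process P X Y" and "c > 0" "b > 1" "k \<le> n"
  shows "AE \<omega> in P. stoch_integral X (of_int k / c) (of_int n / c) (\<lambda>s. b powi \<lfloor>c * s\<rfloor>) \<omega> =
           (\<Sum>l=k+1..n. b powi (l - 1) *\<^sub>R (Y (of_int l / c) \<omega> - Y (of_int (l - 1) / c) \<omega>))"
proof -
  have X: "isrm P X" using Y by (simp add: hisrm_process_def)
  have X0: "AE \<omega> in P. X {a} \<omega> = 0" for a using X by (auto simp: isrm_def)
  define I where "I = {of_int k / c<..of_int n / c}"
  define L where "L m = {u \<in> I. \<lfloor>c * u\<rfloor> = m}" for m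
  have L: "L m = {u. real_of_int k < u * c \<and> u * c \<le> of_int n \<and> of_int m \<le> u * c \<and> u * c < of_int m + 1}" for m
    using \<open>c > 0\<close> unfolding L_def I_def by (auto simp: field_simps floor_eq_iff)
  have inj: "b powi i = b powi j \<longleftrightarrow> i = j" for i j :: int
    using \<open>b > 1\<close> by (metis power_int_strict_increasing linorder_neqE less_irrefl)
  have rng: "\<lfloor>c * u\<rfloor> \<in> {k..n}" if "u \<in> I" for u
    using that \<open>c > 0\<close> unfolding I_def by (auto simp: field_simps le_floor_iff floor_le_iff)
  have Lm: "L m \<in> bounded_borel" for m
  proof -
    have "L m \<subseteq> I" "L m \<in> sets borel" unfolding L_def I_def by auto
    moreover have "bounded (L m)"
      by (rule bounded_subset[OF _ \<open>L m \<subseteq> I\<close>]) (simp add: I_def)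
    ultimately show ?thesis by (simp add: bounded_borel_def)
  qed
  have eq1: "stoch_integral X (of_int k / c) (of_int n / c) (\<lambda>s. b powi \<lfloor>c * s\<rfloor>) \<omega> =
      (\<Sum>m=k..n. b powi m *\<^sub>R X (L m) \<omega>)" if "X {} \<omega> = 0" for \<omega>
  proof -
    have "stoch_integral X (of_int k / c) (of_int n / c) (\<lambda>s. b powi \<lfloor>c * s\<rfloor>) \<omega>
       = (\<Sum>y\<in>(\<lambda>m. b powi m) ` ((\<lambda>u. \<lfloor>c * u\<rfloor>) ` I). y *\<^sub>R X {u \<in> I. b powi \<lfloor>c * u\<rfloor> = y} \<omega>)"
      unfolding stoch_integral_def I_def image_image ..
    also have "\<dots> = (\<Sum>m\<in>(\<lambda>u. \<lfloor>c * u\<rfloor>) ` I. b powi m *\<^sub>R X (L m) \<omega>)"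
      by (subst sum.reindex) (auto simp: inj_on_def inj L_def)
    also have "\<dots> = (\<Sum>m=k..n. b powi m *\<^sub>R X (L m) \<omega>)"
    proof (rule sum.mono_neutral_left)
      show "\<forall>m\<in>{k..n} - (\<lambda>u. \<lfloor>c * u\<rfloor>) ` I. b powi m *\<^sub>R X (L m) \<omega> = 0"
      proof
        fix m assume "m \<in> {k..n} - (\<lambda>u. \<lfloor>c * u\<rfloor>) ` I"
        then have "L m = {}" by (auto simp: L_def)
        then show "b powi m *\<^sub>R X (L m) \<omega> = 0" using that by simp
      qed
    qed (use rng in auto)
    finally show ?thesis .
  qed
  have Ln: "AE \<omega> in P. X (L n) \<omega> = 0"
  proof -
    have "L n \<subseteq> {of_int n / c}" unfolding L using \<open>c > 0\<close> by (auto simp: field_simps)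
    then have "L n = {} \<or> L n = {of_int n / c}" by blast
    then show ?thesis using X0 isrm_empty[OF X] by metis
  qed
  have Lmid: "AE \<omega> in P. X (L m) \<omega> = Y (of_int (m + 1) / c) \<omega> - Y (of_int m / c) \<omega>"
    if m: "k \<le> m" "m < n" for m
  proof -
    let ?p = "real_of_int m / c" and ?q = "real_of_int (m + 1) / c"
    have pq: "?p < ?q" using \<open>c > 0\<close> by (simp add: field_simps)
    have inc: "AE \<omega> in P. Y ?q \<omega> - Y ?p \<omega> = X {?p<..?q} \<omega>"
      using hisrm_process_increment[OF Y] pq by simp
    have "AE \<omega> in P. X ({?p<..<?q} \<union> {?q}) \<omega> = X {?p<..<?q} \<omega> + X {?q} \<omega>"
      by (rule isrm_Un[OF X]) auto
    then have oo: "AE \<omega> in P. X {?p<..?q} \<omega> = X {?p<..<?q} \<omega>"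
      using X0[of ?q]
    proof eventually_elim
      case (elim \<omega>)
      moreover have "{?p<..<?q} \<union> {?q} = {?p<..?q}" using pq by auto
      ultimately show ?case by simp
    qed
    have "L m \<subseteq> {?p..<?q}" "{?p<..<?q} \<subseteq> L m"
    proof -
      show "L m \<subseteq> {?p..<?q}" unfolding L using \<open>c > 0\<close> by (auto simp: field_simps)
      have "real_of_int k \<le> of_int m" "real_of_int m + 1 \<le> of_int n" using m by linarith+
      then show "{?p<..<?q} \<subseteq> L m" unfolding L using \<open>c > 0\<close> by (auto simp: field_simps)
    qed
    moreover have "{?p..<?q} = {?p} \<union> {?p<..<?q}" using pq by auto
    moreover have "A = B \<or> A = {a} \<union> B" if "A \<subseteq> {a} \<union> B" "B \<subseteq> A" for A B :: "real set" and a
      using that by blast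
    ultimately have Lcases: "L m = {?p<..<?q} \<or> L m = {?p} \<union> {?p<..<?q}" by metis
    have "AE \<omega> in P. X ({?p} \<union> {?p<..<?q}) \<omega> = X {?p} \<omega> + X {?p<..<?q} \<omega>"
      by (rule isrm_Un[OF X]) auto
    then have "AE \<omega> in P. X ({?p} \<union> {?p<..<?q}) \<omega> = X {?p<..<?q} \<omega>"
      using X0[of ?p] by eventually_elim simp
    with Lcases have "AE \<omega> in P. X (L m) \<omega> = X {?p<..<?q} \<omega>"
      by (elim disjE) simp_all
    with inc oo show ?thesis by eventually_elim simp
  qed
  have "AE \<omega> in P. \<forall>m\<in>{k..<n}. X (L m) \<omega> = Y (of_int (m + 1) / c) \<omega> - Y (of_int m / c) \<omega>"
    using Lmid by (subst AE_finite_all) auto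
  with Ln isrm_empty[OF X] show ?thesis
  proof eventually_elim
    case (elim \<omega>)
    have "(\<Sum>m=k..n. b powi m *\<^sub>R X (L m) \<omega>) = (\<Sum>m\<in>{k..<n}. b powi m *\<^sub>R X (L m) \<omega>)"
      by (rule sum.mono_neutral_right) (use elim(1) in \<open>auto simp: order.order_iff_strict\<close>)
    also have "\<dots> = (\<Sum>l=k+1..n. b powi (l - 1) *\<^sub>R (Y (of_int l / c) \<omega> - Y (of_int (l - 1) / c) \<omega>))"
      by (rule sum.reindex_bij_witness[of _ "\<lambda>l. l - 1" "\<lambda>l. l + 1"]) (use elim(3) in auto)
    finally show ?case using eq1[OF elim(2)] by simp
  qed
qed

end

theory Submission
  imports Defs
begin

text \<open>All terms of the equation depend on \<open>t\<close> only through \<open>n = [ct]\<close>, because \<open>d[cs]\<close> is counting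
  measure on the grid of points \<open>k/c\<close>. For the values \<open>z\<^sub>n\<close> of a solution at the grid points it is
  therefore the recursion \<open>b z\<^sub>n = z\<^sub>n\<^sub>-\<^sub>1 + (Y\<^sub>n\<^sub>/\<^sub>c - Y\<^sub>(\<^sub>n\<^sub>-\<^sub>1\<^sub>)\<^sub>/\<^sub>c)\<close>, which the given process satisfies; and since
  \<open>b \<noteq> 0\<close> the recursion has only one solution, which determines \<open>Z\<^sub>t\<close> also between grid points.\<close>

section \<open>Functions of \<open>\<lfloor>c * t\<rfloor>\<close> and the grid of points
  \<open>k / c\<close>\<close>

lemma of_int_divide_in_Ioc_iff:
  fixes c s t :: real
  assumes "c > 0"
  shows "of_int k / c \<in> {s<..t} \<longleftrightarrow> k \<in> {\<lfloor>c * s\<rfloor>+1..\<lfloor>c * t\<rfloor>}"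
proof -
  have "s < of_int k / c \<longleftrightarrow> \<lfloor>c * s\<rfloor> < k"
    using assms by (simp add: pos_less_divide_eq floor_less_iff mult.commute)
  moreover have "of_int k / c \<le> t \<longleftrightarrow> k \<le> \<lfloor>c * t\<rfloor>"
    using assms by (simp add: pos_divide_le_eq le_floor_iff mult.commute)
  ultimately show ?thesis by auto
qed

lemma eventually_floor_at_right:
  fixes c t :: real
  assumes "c > 0"
  shows "eventually (\<lambda>s. \<lfloor>c * s\<rfloor> = \<lfloor>c * t\<rfloor>) (at_right t)"
proof -
  have "t < (of_int \<lfloor>c * t\<rfloor> + 1) / c"
    using assms by (simp add: pos_less_divide_eq mult.commute)
  then have "eventually (\<lambda>s. s \<in> {t<..<(of_int \<lfloor>c * t\<rfloor> + 1) / c}) (at_right t)"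
    by (rule eventually_at_right_real)
  then show ?thesis
  proof eventually_elim
    case (elim s)
    then have "c * t < c * s" "c * s < of_int \<lfloor>c * t\<rfloor> + 1"
      using assms by (auto simp: pos_less_divide_eq mult.commute)
    then show ?case by linarith
  qed
qed

text \<open>Just left of \<open>t\<close> the floor of \<open>c * s\<close> agrees with that of
  \<open>c * t\<close> off the grid, but is one less if \<open>t\<close> is a grid point;
  \<open>\<lceil>c * t\<rceil> - 1\<close> covers both cases.\<close>

lemma eventually_floor_at_left:
  fixes c t :: real
  assumes "c > 0"
  shows "eventually (\<lambda>s. \<lfloor>c * s\<rfloor> = \<lceil>c * t\<rceil> - 1) (at_left t)"
proof -
  have "(of_int \<lceil>c * t\<rceil> - 1) / c < t"
    using assms by (simp add: pos_divide_less_eq mult.commute) linarith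
  then have "eventually (\<lambda>s. s \<in> {(of_int \<lceil>c * t\<rceil> - 1) / c<..<t}) (at_left t)"
    by (rule eventually_at_left_real)
  then show ?thesis
  proof eventually_elim
    case (elim s)
    then have "c * s < c * t" "of_int \<lceil>c * t\<rceil> - 1 < c * s"
      using assms by (auto simp: pos_divide_less_eq mult.commute)
    then show ?case by linarith
  qed
qed

text \<open>Such a function is constant on a one-sided neighbourhood of \<open>t\<close> within
  \<open>T\<close>, on either side, whatever \<open>h\<close> is. This yields the path regularity of
  the explicit process.\<close>

lemma cadlag_on_floor:
  fixes c :: real
  assumes "c > 0" and f: "\<And>t. t \<in> T \<Longrightarrow> f t = h \<lfloor>c * t\<rfloor>"
  shows "cadlag_on T f"
  unfolding cadlag_on_def
proof (intro ballI conjI)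
  fix t assume t: "t \<in> T"
  have "eventually (\<lambda>s. f s = f t) (at t within T \<inter> {t<..})"
  proof -
    have "eventually (\<lambda>s. \<lfloor>c * s\<rfloor> = \<lfloor>c * t\<rfloor>) (at t within T \<inter> {t<..})"
      using eventually_floor_at_right[OF \<open>c > 0\<close>] by (rule filter_leD[OF at_le, rotated]) auto
    moreover have "eventually (\<lambda>s. s \<in> T) (at t within T \<inter> {t<..})"
      by (simp add: eventually_at_filter)
    ultimately show ?thesis by eventually_elim (simp add: f t)
  qed
  then show "(f \<longlongrightarrow> f t) (at t within T \<inter> {t<..})" by (rule tendsto_eventually)
  have "eventually (\<lambda>s. f s = h (\<lceil>c * t\<rceil> - 1)) (at t within T \<inter> {..<t})"
  proof -
    have "eventually (\<lambda>s. \<lfloor>c * s\<rfloor> = \<lceil>c * t\<rceil> - 1) (at t within T \<inter> {..<t})"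
      using eventually_floor_at_left[OF \<open>c > 0\<close>] by (rule filter_leD[OF at_le, rotated]) auto
    moreover have "eventually (\<lambda>s. s \<in> T) (at t within T \<inter> {..<t})"
      by (simp add: eventually_at_filter)
    ultimately show ?thesis by eventually_elim (simp add: f)
  qed
  then show "\<exists>l. (f \<longlongrightarrow> l) (at t within T \<inter> {..<t})" by (blast intro: tendsto_eventually)
qed

section \<open>The integral with respect to \<open>d[cs]\<close> as a finite sum\<close>

text \<open>By right-continuity, \<open>f\<close> is on the interval the pointwise limit of step
  functions that sample \<open>f\<close> slightly to the right. The indicator cuts off the points
  below \<open>t0\<close>, where nothing is known about \<open>f\<close>.\<close>

lemma cadlag_on_indicator_measurable:
  fixes f :: "real \<Rightarrow> 'a::euclidean_space"
  assumes "cadlag_on {t0..} f"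
  shows "(\<lambda>s. indicator {t0<..t} s *\<^sub>R f s) \<in> borel_measurable borel"
proof (rule borel_measurable_LIMSEQ_metric)
  \<comment> \<open>\<open>r n s\<close> is the least multiple of \<open>1 / Suc n\<close> strictly
    above \<open>s\<close>; strictness lets the limit from the right apply.\<close>
  define r where "r n s = (of_int \<lfloor>real (Suc n) * s\<rfloor> + 1) / real (Suc n)" for n s
  show "(\<lambda>s. indicator {t0<..t} s *\<^sub>R f (r n s)) \<in> borel_measurable borel" for n
  proof (rule borel_measurable_scaleR)
    \<comment> \<open>The sampled function factors through the discrete space of integers, so it is
      measurable for any \<open>f\<close>.\<close>
    have "(\<lambda>k::int. f ((of_int k + 1) / real (Suc n))) \<circ> (\<lambda>s. \<lfloor>real (Suc n) * s\<rfloor>)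
        \<in> borel_measurable borel"
      by (rule measurable_comp[where N = "count_space UNIV"]) simp_all
    then show "(\<lambda>s. f (r n s)) \<in> borel_measurable borel"
      by (simp add: r_def comp_def)
  qed simp
  fix s :: real
  show "(\<lambda>n. indicator {t0<..t} s *\<^sub>R f (r n s)) \<longlonglongrightarrow> indicator {t0<..t} s *\<^sub>R f s"
  proof (cases "s \<in> {t0<..t}")
    case True
    have r: "s < r n s" "r n s \<le> s + 1 / real (Suc n)" for n
    proof -
      have "real (Suc n) * s < of_int \<lfloor>real (Suc n) * s\<rfloor> + 1" by linarith
      then show "s < r n s" by (simp add: r_def pos_less_divide_eq mult.commute)
      have "r n s \<le> (real (Suc n) * s + 1) / real (Suc n)"
        unfolding r_def by (rule divide_right_mono) (simp_all del: of_nat_Suc)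
      then show "r n s \<le> s + 1 / real (Suc n)"
        by (simp add: add_divide_distrib del: of_nat_Suc)
    qed
    have "(\<lambda>n. s + 1 / real (Suc n)) \<longlonglongrightarrow> s"
      using tendsto_add[OF tendsto_const[of s] LIMSEQ_Suc[OF lim_1_over_n]] by simp
    then have "(\<lambda>n. r n s) \<longlonglongrightarrow> s"
      by (rule tendsto_sandwich[OF _ _ tendsto_const, rotated 2])
        (auto intro!: always_eventually less_imp_le[OF r(1)] r(2) simp del: of_nat_Suc)
    moreover have "r n s \<in> {t0..} \<inter> {s<..} \<and> r n s \<noteq> s" for n
      using True r(1)[of n] by auto
    ultimately have "filterlim (\<lambda>n. r n s) (at s within {t0..} \<inter> {s<..}) sequentially"
      unfolding filterlim_at by (blast intro: always_eventually)
    moreover have "(f \<longlongrightarrow> f s) (at s within {t0..} \<inter> {s<..})"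
      using assms True by (auto simp: cadlag_on_def)
    ultimately have "(\<lambda>n. f (r n s)) \<longlonglongrightarrow> f s" by (rule filterlim_compose[rotated])
    then show ?thesis using True by simp
  qed simp
qed

text \<open>The half-open intervals are stable under intersection and generate the Borel sets, and
  on \<open>{u<..v}\<close> both measures count the integers \<open>k\<close> with
  \<open>k / c\<close> in it. Finite mass of the intervals \<open>{- real i<..real i}\<close> then
  gives equality everywhere.\<close>

lemma interval_measure_floor:
  fixes c :: real
  assumes "c > 0"
  shows "interval_measure (\<lambda>s. of_int \<lfloor>c * s\<rfloor>) =
    distr (count_space UNIV) borel (\<lambda>k::int. of_int k / c)" (is "?M = ?N")
proof (rule measure_eqI_generator_eq[where \<Omega>=UNIV])
  have M: "emeasure ?M {u<..v} = ennreal (of_int \<lfloor>c * v\<rfloor> - of_int \<lfloor>c * u\<rfloor>)" if "u \<le> v" for u v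
  proof (rule emeasure_interval_measure_Ioc[OF that])
    show "of_int \<lfloor>c * x\<rfloor> \<le> (of_int \<lfloor>c * y\<rfloor> :: real)" if "x \<le> y" for x y
      using that assms by (simp add: floor_mono)
    show "continuous (at_right x) (\<lambda>s. of_int \<lfloor>c * s\<rfloor> :: real)" for x
      unfolding continuous_within
      using eventually_floor_at_right[OF assms, of x] by (intro tendsto_eventually) (simp add: eventually_mono)
  qed
  show "emeasure ?M A = emeasure ?N A" if A_in: "A \<in> range (\<lambda>(u, v). {u<..v})" for A
  proof -
    obtain u v where A: "A = {u<..v}" using A_in by auto
    show ?thesis
    proof (cases "u \<le> v")
      case True
      have "(\<lambda>k::int. of_int k / c) -` {u<..v} = {\<lfloor>c * u\<rfloor>+1..\<lfloor>c * v\<rfloor>}"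
        using of_int_divide_in_Ioc_iff[OF assms, of _ u v] by blast
      then have "emeasure ?N A = emeasure (count_space UNIV) {\<lfloor>c * u\<rfloor>+1..\<lfloor>c * v\<rfloor>}"
        by (simp add: A emeasure_distr)
      also have "\<dots> = ennreal (of_int \<lfloor>c * v\<rfloor> - of_int \<lfloor>c * u\<rfloor>)"
      proof -
        have "\<lfloor>c * u\<rfloor> \<le> \<lfloor>c * v\<rfloor>" using True assms by (simp add: floor_mono)
        then have "real (nat (\<lfloor>c * v\<rfloor> - \<lfloor>c * u\<rfloor>)) = of_int \<lfloor>c * v\<rfloor> - of_int \<lfloor>c * u\<rfloor>" by simp
        then show ?thesis by (simp add: emeasure_count_space ennreal_of_nat_eq_real_of_nat)
      qed
      finally show ?thesis using M[OF True] A by simp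
    qed (simp add: A)
  qed
  show "(\<Union>i. {- real i<..real i}) = UNIV" by (rule UN_Ioc_eq_UNIV)
  show "emeasure ?M {- real i<..real i} \<noteq> \<infinity>" for i by (simp add: M)
qed (auto simp: borel_sigma_sets_Ioc Int_stable_def)

text \<open>The change of variables \<open>k \<mapsto> k / c\<close> leads to counting measure on
  the integers, and only finitely many grid points lie in \<open>{t0<..t}\<close>. The sum starts at
  \<open>\<lfloor>c * t0\<rfloor> + 1\<close> because a grid point at \<open>t0\<close> itself is
  excluded.\<close>

lemma set_integral_floor:
  fixes f :: "real \<Rightarrow> 'a::euclidean_space"
  assumes "c > 0" and f: "cadlag_on {t0..} f"
  shows "(LINT s:{t0<..t}|interval_measure (\<lambda>s. of_int \<lfloor>c * s\<rfloor>). f s) =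
    (\<Sum>k=\<lfloor>c * t0\<rfloor>+1..\<lfloor>c * t\<rfloor>. f (of_int k / c))"
proof -
  let ?K = "{\<lfloor>c * t0\<rfloor>+1..\<lfloor>c * t\<rfloor>}"
  let ?g = "\<lambda>k::int. indicator ?K k *\<^sub>R f (of_int k / c)"
  have "(LINT s:{t0<..t}|interval_measure (\<lambda>s. of_int \<lfloor>c * s\<rfloor>). f s) =
      (LINT k|count_space UNIV. indicator {t0<..t} (of_int k / c) *\<^sub>R f (of_int k / c))"
    unfolding set_lebesgue_integral_def interval_measure_floor[OF \<open>c > 0\<close>]
    by (rule integral_distr) (simp_all add: cadlag_on_indicator_measurable[OF f])
  also have "(\<lambda>k::int. indicator {t0<..t} (of_int k / c) *\<^sub>R f (of_int k / c)) = ?g"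
    using of_int_divide_in_Ioc_iff[OF \<open>c > 0\<close>, of _ t0 t] by (auto simp: indicator_def fun_eq_iff)
  \<comment> \<open>This sum runs over the support of \<open>?g\<close>, which can be smaller than
    \<open>?K\<close> where \<open>f\<close> vanishes; the next step fills in the zero
    terms.\<close>
  also have "(LINT k|count_space UNIV. ?g k) = (\<Sum>k | k \<in> UNIV \<and> ?g k \<noteq> 0. ?g k)"
    by (rule lebesgue_integral_count_space_finite_support)
      (rule finite_subset[of _ ?K], auto simp: indicator_def)
  also have "\<dots> = (\<Sum>k\<in>?K. f (of_int k / c))"
    by (rule sum.mono_neutral_cong_left) (auto simp: indicator_def)
  finally show ?thesis .
qed

section \<open>The recursion at the grid points, path by path\<close>

text \<open>Induction on \<open>n\<close>: the difference of the equations at \<open>n + 1\<close>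
  and \<open>n\<close> rearranges to the one-step relation \<open>rec\<close>, which the explicit
  formula satisfies.\<close>

lemma langevin_recursion_solution:
  fixes y :: "int \<Rightarrow> 'a::real_vector" and m :: 'a and b :: real
  assumes "b \<noteq> 0" and "n0 \<le> n"
  defines "z \<equiv> \<lambda>n. b powi (- (n - n0)) *\<^sub>R m +
    b powi (- n) *\<^sub>R (\<Sum>l=n0+1..n. b powi (l - 1) *\<^sub>R (y l - y (l - 1)))"
  shows "z n = m + y n - y n0 - (b - 1) *\<^sub>R (\<Sum>k=n0+1..n. z k)"
  using \<open>n0 \<le> n\<close>
proof (induction n rule: int_ge_induct)
  case base
  show ?case by (simp add: z_def)
next
  case (step n)
  have ivl: "{n0+1..n+1} = insert (n+1) {n0+1..n}" using step.hyps by auto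
  \<comment> \<open>Multiplying by \<open>b\<close> turns both powers at \<open>n + 1\<close> into
    those at \<open>n\<close>, and the weight \<open>b powi n\<close> of the new increment cancels
    against \<open>b powi (- n)\<close>.\<close>
  have rec: "b *\<^sub>R z (n + 1) = z n + (y (n + 1) - y n)"
  proof -
    have pow: "b * b powi (- (n + 1 - n0)) = b powi (- (n - n0))" "b * b powi (- (n + 1)) = b powi (- n)"
      using power_int_add_1'[of b "- (n + 1 - n0)"] power_int_add_1'[of b "- (n + 1)"] \<open>b \<noteq> 0\<close>
      by (simp_all add: algebra_simps)
    have one: "b powi (- n) * b powi n = 1"
      using \<open>b \<noteq> 0\<close> by (simp add: power_int_minus)
    define S where "S = (\<Sum>l=n0+1..n. b powi (l - 1) *\<^sub>R (y l - y (l - 1)))"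
    have "(\<Sum>l=n0+1..n+1. b powi (l - 1) *\<^sub>R (y l - y (l - 1))) = b powi n *\<^sub>R (y (n + 1) - y n) + S"
      by (simp add: ivl S_def)
    then have "b *\<^sub>R z (n + 1) = (b * b powi (- (n + 1 - n0))) *\<^sub>R m +
        (b * b powi (- (n + 1))) *\<^sub>R (b powi n *\<^sub>R (y (n + 1) - y n) + S)"
      unfolding z_def by (simp only: scaleR_add_right scaleR_scaleR mult.assoc)
    also have "\<dots> = b powi (- (n - n0)) *\<^sub>R m + b powi (- n) *\<^sub>R S + (y (n + 1) - y n)"
      unfolding pow by (simp only: scaleR_add_right scaleR_scaleR one scaleR_one add_ac)
    finally show ?thesis by (simp only: z_def S_def)
  qed
  have sum_Suc: "(\<Sum>k=n0+1..n+1. z k) = z (n + 1) + (\<Sum>k=n0+1..n. z k)"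
    unfolding ivl by simp
  \<comment> \<open>This splitting brings in \<open>b *\<^sub>R z (n + 1)\<close>, to which
    \<open>rec\<close> applies, and leaves exactly the new term of the sum.\<close>
  have "z (n + 1) = b *\<^sub>R z (n + 1) - (b - 1) *\<^sub>R z (n + 1)"
    by (simp add: scaleR_diff_left)
  then have "z (n + 1) = z n + (y (n + 1) - y n) - (b - 1) *\<^sub>R z (n + 1)"
    unfolding rec .
  also have "\<dots> = m + y (n + 1) - y n0 - (b - 1) *\<^sub>R (\<Sum>k=n0+1..n+1. z k)"
    unfolding step.IH sum_Suc scaleR_add_right by simp
  finally show ?case .
qed

text \<open>The common term \<open>a\<close> drops out of the difference \<open>d\<close>, which
  solves a homogeneous equation. Induction shows that \<open>d\<close> vanishes at all grid points
  after \<open>t0\<close>; at any other \<open>t\<close> the equation then expresses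
  \<open>d t\<close> by a sum of zeros.\<close>

lemma langevin_recursion_unique:
  fixes z1 z2 :: "real \<Rightarrow> 'a::real_vector" and b c t0 :: real
  assumes "b \<noteq> 0" "c > 0"
    and z1: "\<And>t. t \<ge> t0 \<Longrightarrow>
      z1 t = a \<lfloor>c * t\<rfloor> - (b - 1) *\<^sub>R (\<Sum>k=\<lfloor>c * t0\<rfloor>+1..\<lfloor>c * t\<rfloor>. z1 (of_int k / c))"
    and z2: "\<And>t. t \<ge> t0 \<Longrightarrow>
      z2 t = a \<lfloor>c * t\<rfloor> - (b - 1) *\<^sub>R (\<Sum>k=\<lfloor>c * t0\<rfloor>+1..\<lfloor>c * t\<rfloor>. z2 (of_int k / c))"
    and "t \<ge> t0"
  shows "z1 t = z2 t"
proof -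
  define n0 where "n0 = \<lfloor>c * t0\<rfloor>"
  define d where "d t = z1 t - z2 t" for t
  have d: "d t = - ((b - 1) *\<^sub>R (\<Sum>k=n0+1..\<lfloor>c * t\<rfloor>. d (of_int k / c)))" if "t \<ge> t0" for t
    using z1[OF that] z2[OF that] by (simp add: d_def n0_def sum_subtractf scaleR_diff_right)
  have grid: "\<forall>k\<in>{n0+1..n}. d (of_int k / c) = 0" if "n0 \<le> n" for n
    using that
  proof (induction n rule: int_ge_induct)
    case base
    show ?case by simp
  next
    case (step n)
    let ?u = "of_int (n + 1) / c"
    have ivl: "{n0+1..n+1} = insert (n+1) {n0+1..n}" using step.hyps by auto
    \<comment> \<open>The equation is available only from \<open>t0\<close> on, so the new grid
      point has to be located there.\<close>
    have "c * t0 < of_int (n + 1)" using step.hyps by (simp add: n0_def) linarith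
    then have "t0 \<le> ?u" using \<open>c > 0\<close> by (simp add: field_simps)
    moreover have "\<lfloor>c * ?u\<rfloor> = n + 1" using \<open>c > 0\<close> by simp
    ultimately have "d ?u = - ((b - 1) *\<^sub>R (\<Sum>k=n0+1..n+1. d (of_int k / c)))"
      using d[of ?u] by metis
    \<comment> \<open>The earlier terms vanish by induction, but the last one is the unknown value
      itself: the equation is implicit, and moving this term to the left gives the factor
      \<open>b\<close>.\<close>
    also have "(\<Sum>k=n0+1..n+1. d (of_int k / c)) = d ?u"
      using step.IH by (simp add: ivl)
    finally have "d ?u + (b - 1) *\<^sub>R d ?u = 0" unfolding eq_neg_iff_add_eq_0 .
    then have "b *\<^sub>R d ?u = 0" by (simp add: scaleR_diff_left)
    then show ?case using step.IH \<open>b \<noteq> 0\<close> by (auto simp: ivl)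
  qed
  have "n0 \<le> \<lfloor>c * t\<rfloor>" using \<open>c > 0\<close> \<open>t \<ge> t0\<close> by (simp add: n0_def floor_mono)
  from grid[OF this] d[OF \<open>t \<ge> t0\<close>] have "d t = 0" by simp
  then show ?thesis by (simp add: d_def)
qed

section \<open>Measurability, existence and uniqueness for the process\<close>

text \<open>The level sets of a Borel function inside \<open>{s<..t}\<close> are bounded Borel sets,
  so each summand is a random variable. If there are infinitely many levels, the sum is 0 by
  convention.\<close>

lemma stoch_integral_measurable:
  assumes "isrm P X" and "f \<in> borel_measurable borel"
  shows "stoch_integral X s t f \<in> borel_measurable P"
  unfolding stoch_integral_def
proof (intro borel_measurable_sum borel_measurable_scaleR)
  fix y
  have "{u \<in> {s<..t}. f u = y} \<in> bounded_borel"
  proof -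
    have "{s<..t} \<inter> {u \<in> space borel. f u = y} \<in> sets borel" using assms(2) by measurable
    moreover have "bounded {u \<in> {s<..t}. f u = y}" by (rule bounded_subset[of "{s<..t}"]) auto
    moreover have "{s<..t} \<inter> {u \<in> space borel. f u = y} = {u \<in> {s<..t}. f u = y}" by auto
    ultimately show ?thesis by (simp add: bounded_borel_def)
  qed
  then show "X {u \<in> {s<..t}. f u = y} \<in> borel_measurable P"
    using assms(1) by (simp add: isrm_def)
qed simp

theorem theorem4p1:
  fixes P :: "'w measure"
    and X :: "real set \<Rightarrow> 'w \<Rightarrow> 'a::euclidean_space"
    and Y :: "real \<Rightarrow> 'w \<Rightarrow> 'a"
    and M :: "'w \<Rightarrow> 'a"
    and t0 c b :: real
    and Z :: "real \<Rightarrow> 'w \<Rightarrow> 'a"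
  assumes "prob_space P"
    and "hisrm_process P X Y"
    and "c > 0" and "b > 1"
    and "M \<in> borel_measurable P"
    and "\<And>t \<omega>. t \<ge> t0 \<Longrightarrow> Z t \<omega> =
      b powi (- (\<lfloor>c * t\<rfloor> - \<lfloor>c * t0\<rfloor>)) *\<^sub>R M \<omega> +
      b powi (- \<lfloor>c * t\<rfloor>) *\<^sub>R
        stoch_integral X (of_int \<lfloor>c * t0\<rfloor> / c) (of_int \<lfloor>c * t\<rfloor> / c) (\<lambda>s. b powi \<lfloor>c * s\<rfloor>) \<omega>"
  shows "langevin_solution P Y M t0 c b Z \<and>
    (\<forall>Z1 Z2. langevin_solution P Y M t0 c b Z1 \<longrightarrow> langevin_solution P Y M t0 c b Z2 \<longrightarrow>
      (AE \<omega> in P. \<forall>t\<ge>t0. Z1 t \<omega> = Z2 t \<omega>))"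
proof (intro conjI allI impI)
  have X: "isrm P X" using assms(2) by (simp add: hisrm_process_def)
  let ?n0 = "\<lfloor>c * t0\<rfloor>"
  let ?S = "\<lambda>n \<omega>. stoch_integral X (of_int ?n0 / c) (of_int n / c) (\<lambda>s. b powi \<lfloor>c * s\<rfloor>) \<omega>"
  have cadlag: "cadlag_on {t0..} (\<lambda>t. Z t \<omega>)" for \<omega>
    by (rule cadlag_on_floor[OF \<open>c > 0\<close>, where h = "\<lambda>n. b powi (- (n - ?n0)) *\<^sub>R M \<omega> + b powi (- n) *\<^sub>R ?S n \<omega>"])
      (simp add: assms(6))
  show "langevin_solution P Y M t0 c b Z"
    unfolding langevin_solution_def
  proof (intro conjI allI impI ballI)
    fix t assume "t \<ge> t0"
    have pw: "(\<lambda>s. b powi \<lfloor>c * s\<rfloor>) \<in> borel_measurable borel"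
    proof -
      have "(\<lambda>k::int. b powi k) \<circ> (\<lambda>s. \<lfloor>c * s\<rfloor>) \<in> borel_measurable borel"
        by (rule measurable_comp[where N = "count_space UNIV"]) simp_all
      then show ?thesis by (simp add: comp_def)
    qed
    have "(\<lambda>\<omega>. b powi (- (\<lfloor>c * t\<rfloor> - ?n0)) *\<^sub>R M \<omega> + b powi (- \<lfloor>c * t\<rfloor>) *\<^sub>R ?S \<lfloor>c * t\<rfloor> \<omega>)
        \<in> borel_measurable P"
      using assms(5) stoch_integral_measurable[OF X pw] by (intro borel_measurable_add borel_measurable_scaleR) auto
    then show "Z t \<in> borel_measurable P" unfolding assms(6)[OF \<open>t \<ge> t0\<close>, symmetric] .
  next
    \<comment> \<open>The exceptional null set of the integral formula depends on \<open>n\<close>.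
      As there are only countably many \<open>n\<close>, one null set serves them all, and hence all
      real \<open>t \<ge> t0\<close>.\<close>
    have "AE \<omega> in P. \<forall>n\<in>{?n0..}. ?S n \<omega> =
        (\<Sum>l=?n0+1..n. b powi (l - 1) *\<^sub>R (Y (of_int l / c) \<omega> - Y (of_int (l - 1) / c) \<omega>))"
      by (rule AE_ball_countable')
        (use stoch_integral_step[OF assms(2,3,4)] in auto)
    then show "AE \<omega> in P. \<forall>t\<ge>t0. Z t \<omega> = M \<omega> + Y (of_int \<lfloor>c * t\<rfloor> / c) \<omega> - Y (of_int ?n0 / c) \<omega>
          - (b - 1) *\<^sub>R (LINT s:{t0<..t}|interval_measure (\<lambda>s. of_int \<lfloor>c * s\<rfloor>). Z s \<omega>)"
    proof eventually_elim
      case (elim \<omega>)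
      define z where "z n = b powi (- (n - ?n0)) *\<^sub>R M \<omega> + b powi (- n) *\<^sub>R
        (\<Sum>l=?n0+1..n. b powi (l - 1) *\<^sub>R (Y (of_int l / c) \<omega> - Y (of_int (l - 1) / c) \<omega>))" for n
      have Z: "Z t \<omega> = z \<lfloor>c * t\<rfloor>" if "t \<ge> t0" for t
      proof -
        have "?n0 \<le> \<lfloor>c * t\<rfloor>" using \<open>c > 0\<close> that by (simp add: floor_mono)
        then show ?thesis using elim by (simp add: assms(6)[OF that] z_def)
      qed
      show ?case
      proof (intro allI impI)
        fix t assume t: "t \<ge> t0"
        have n: "?n0 \<le> \<lfloor>c * t\<rfloor>" using \<open>c > 0\<close> t by (simp add: floor_mono)
        have "(\<Sum>k=?n0+1..\<lfloor>c * t\<rfloor>. Z (of_int k / c) \<omega>) = (\<Sum>k=?n0+1..\<lfloor>c * t\<rfloor>. z k)"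
        proof (rule sum.cong[OF refl])
          fix k assume "k \<in> {?n0+1..\<lfloor>c * t\<rfloor>}"
          then have "t0 \<le> of_int k / c"
            using of_int_divide_in_Ioc_iff[OF \<open>c > 0\<close>, of k t0 t] by simp
          then show "Z (of_int k / c) \<omega> = z k" using Z \<open>c > 0\<close> by simp
        qed
        then show "Z t \<omega> = M \<omega> + Y (of_int \<lfloor>c * t\<rfloor> / c) \<omega> - Y (of_int ?n0 / c) \<omega>
          - (b - 1) *\<^sub>R (LINT s:{t0<..t}|interval_measure (\<lambda>s. of_int \<lfloor>c * s\<rfloor>). Z s \<omega>)"
          using langevin_recursion_solution[OF _ n, of b "M \<omega>" "\<lambda>l. Y (of_int l / c) \<omega>"] \<open>b > 1\<close>
          by (simp add: set_integral_floor[OF \<open>c > 0\<close> cadlag] Z[OF t] z_def)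
      qed
    qed
  qed (rule cadlag)
next
  fix Z1 Z2
  assume "langevin_solution P Y M t0 c b Z1" "langevin_solution P Y M t0 c b Z2"
  then have cadlag: "\<forall>\<omega>\<in>space P. cadlag_on {t0..} (\<lambda>t. Z1 t \<omega>) \<and> cadlag_on {t0..} (\<lambda>t. Z2 t \<omega>)"
    and eq1: "AE \<omega> in P. \<forall>t\<ge>t0.
        Z1 t \<omega> = M \<omega> + Y (of_int \<lfloor>c * t\<rfloor> / c) \<omega> - Y (of_int \<lfloor>c * t0\<rfloor> / c) \<omega>
          - (b - 1) *\<^sub>R (LINT s:{t0<..t}|interval_measure (\<lambda>s. of_int \<lfloor>c * s\<rfloor>). Z1 s \<omega>)"
    and eq2: "AE \<omega> in P. \<forall>t\<ge>t0.
        Z2 t \<omega> = M \<omega> + Y (of_int \<lfloor>c * t\<rfloor> / c) \<omega> - Y (of_int \<lfloor>c * t0\<rfloor> / c) \<omega>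
          - (b - 1) *\<^sub>R (LINT s:{t0<..t}|interval_measure (\<lambda>s. of_int \<lfloor>c * s\<rfloor>). Z2 s \<omega>)"
    by (simp_all add: langevin_solution_def)
  show "AE \<omega> in P. \<forall>t\<ge>t0. Z1 t \<omega> = Z2 t \<omega>"
    \<comment> \<open>The paths are known to be cadlag only on \<open>space P\<close>, so
      \<open>\<omega>\<close> is taken from there as well.\<close>
    using AE_space eq1 eq2
  proof eventually_elim
    case (elim \<omega>)
    have c1: "cadlag_on {t0..} (\<lambda>t. Z1 t \<omega>)" and c2: "cadlag_on {t0..} (\<lambda>t. Z2 t \<omega>)"
      using cadlag elim(1) by auto
    show ?case
    proof (intro allI impI)
      fix t assume "t \<ge> t0"
      show "Z1 t \<omega> = Z2 t \<omega>"
      \<comment> \<open>For fixed \<open>\<omega>\<close> both integrals are sums over grid points,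
        and \<open>a\<close> collects the terms that the two equations share.\<close>
      proof (rule langevin_recursion_unique[where b = b and c = c and ?t0.0 = t0 and t = t
            and ?z1.0 = "\<lambda>t. Z1 t \<omega>" and ?z2.0 = "\<lambda>t. Z2 t \<omega>"
            and a = "\<lambda>n. M \<omega> + Y (of_int n / c) \<omega> - Y (of_int \<lfloor>c * t0\<rfloor> / c) \<omega>"])
        fix t assume "t \<ge> t0"
        note eq = elim(2)[rule_format, OF this] elim(3)[rule_format, OF this]
        show "Z1 t \<omega> = M \<omega> + Y (of_int \<lfloor>c * t\<rfloor> / c) \<omega> - Y (of_int \<lfloor>c * t0\<rfloor> / c) \<omega>
            - (b - 1) *\<^sub>R (\<Sum>k=\<lfloor>c * t0\<rfloor>+1..\<lfloor>c * t\<rfloor>. Z1 (of_int k / c) \<omega>)"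
          using eq(1) unfolding set_integral_floor[OF \<open>c > 0\<close> c1] .
        show "Z2 t \<omega> = M \<omega> + Y (of_int \<lfloor>c * t\<rfloor> / c) \<omega> - Y (of_int \<lfloor>c * t0\<rfloor> / c) \<omega>
            - (b - 1) *\<^sub>R (\<Sum>k=\<lfloor>c * t0\<rfloor>+1..\<lfloor>c * t\<rfloor>. Z2 (of_int k / c) \<omega>)"
          using eq(2) unfolding set_integral_floor[OF \<open>c > 0\<close> c2] .
      qed (use \<open>b > 1\<close> \<open>c > 0\<close> \<open>t \<ge> t0\<close> in auto)
    qed
  qed
qed

end
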